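(* Let $t=t(n)\in\omega(n/\log n)$. Let $\pi^1,\ldots,\pi^t$ be taken from $S_{n-1}$ independently and uniformly at random. Let $\varepsilon:=\sqrt{\ln n/(n-1)}$, $f<(n-1)(1-\varepsilon)$, and $p:=1-\frac{f}{n-1}$. Then there are $c=c(n)\le 6+o(1)$ and $\delta=\delta(n)$ with $\lim_{n\to\infty}\delta(n)=0$ such that the probability (over the choice of $\pi^1,\ldots,\pi^t$) that $\mathrm{GP}(\pi^1,\ldots,\pi^t)$ is $\left(f,\,1-\delta,\,\frac{c}{p-\varepsilon}\left(\lceil\log(n-1)\rceil+1\right)\right)$-safe is $1-o(n^{-1})$.
   Context: $\log$ is to base 2, $\ln$ the natural logarithm, $[m]=\{1,\ldots,m\}$, $S_{n-1}$ the set of permutations of $[n-1]$. For a sequence $s=(s_1,s_2,\ldots)$, $\mathrm{ODD}(s)=(s_1,s_3,\ldots)$, $\mathrm{EVEN}(s)=(s_2,s_4,\ldots)$. There are $n$ processors $0,\ldots,n-1$; processor $0$ initially holds the rumor and is non-faulty; a failure pattern is a set $F\subseteq[n-1]$ of faulty processors, which never send messages or respond (a caller learns that a call to a faulty processor failed). The algorithm $\mathrm{GP}(\pi^1,\ldots,\pi^t)$ (with the permutations stored at all processors): processor $0$ chooses an index $r\in[t]$ uniformly at random; initially processor $0$ holds the list $(1,\ldots,n-1)$ and all others empty lists. In each synchronous round, every processor $i$ holding a nonempty list $(j_1,\ldots,j_k)$ sends a communication request to processor $\pi^r(j_1)$ and deletes $j_1$ from its list; if $\pi^r(j_1)$ is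 non-faulty, $i$ sends it the rumor together with $r$ and the list $\mathrm{EVEN}(j_2,\ldots,j_k)$, which becomes the list of $\pi^r(j_1)$, and $i$ sets its own list to $\mathrm{ODD}(j_2,\ldots,j_k)$ (otherwise $i$ continues with $(j_2,\ldots,j_k)$). The algorithm terminates when all lists are empty; its runtime is the number of rounds until termination. $\mathrm{GP}(\pi^1,\ldots,\pi^t)$ is called $(f,r,T)$-safe if for every failure pattern $F\subseteq[n-1]$ with $|F|=f$, with probability at least $r$ over the random choice of the index in $[t]$, the runtime of $\mathrm{GP}(\pi^1,\ldots,\pi^t)$ with failure pattern $F$ is at most $T$. Asymptotic notation refers to $n\to\infty$. *)

theory Defs
  imports
    "HOL-Probability.Probability"
    "HOL-Probability.Product_PMF"
    "HOL-Combinatorics.Permutations"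
    "HOL-Library.Landau_Symbols"
begin

(* Lists are indexed from 0, so s_1, s_3, ... sit at the even positions. *)

definition ODD :: "'a list \<Rightarrow> 'a list" where
  "ODD s = nths s {i. even i}"

definition EVEN :: "'a list \<Rightarrow> 'a list" where
  "EVEN s = nths s {i. odd i}"

type_synonym config = "nat \<Rightarrow> nat list"

definition calls :: "(nat \<Rightarrow> nat) \<Rightarrow> config \<Rightarrow> nat \<Rightarrow> nat \<Rightarrow> bool" where
  "calls \<pi> L i k \<longleftrightarrow> L i \<noteq> [] \<and> \<pi> (hd (L i)) = k"

(* One synchronous round on the processors 0, ..., n - 1. In every reachable configuration the
   entries of all lists are distinct, so if \<pi> is a permutation a processor has at most one
   caller in the whole run, and the definite description below is well-defined. *)

definition gp_round :: "nat \<Rightarrow> (nat \<Rightarrow> nat) \<Rightarrow> nat set \<Rightarrow> config \<Rightarrow> config" where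
  "gp_round n \<pi> F L k =
     (if k \<notin> F \<and> (\<exists>i<n. calls \<pi> L i k) then EVEN (tl (L (THE i. i < n \<and> calls \<pi> L i k)))
      else if L k = [] then []
      else if \<pi> (hd (L k)) \<in> F then tl (L k)
      else ODD (tl (L k)))"

definition gp_init :: "nat \<Rightarrow> config" where
  "gp_init n = (\<lambda>_. [])(0 := [1..<n])"

definition gp_config :: "nat \<Rightarrow> (nat \<Rightarrow> nat) \<Rightarrow> nat set \<Rightarrow> nat \<Rightarrow> config" where
  "gp_config n \<pi> F m = (gp_round n \<pi> F ^^ m) (gp_init n)"

definition gp_runtime :: "nat \<Rightarrow> (nat \<Rightarrow> nat) \<Rightarrow> nat set \<Rightarrow> nat" where
  "gp_runtime n \<pi> F = (LEAST m. \<forall>i<n. gp_config n \<pi> F m i = [])"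

(* \<pi> k is the k-th stored permutation, for 1 \<le> k \<le> t. *)

definition gp_safe :: "nat \<Rightarrow> nat \<Rightarrow> (nat \<Rightarrow> nat \<Rightarrow> nat) \<Rightarrow> nat \<Rightarrow> real \<Rightarrow> real \<Rightarrow> bool" where
  "gp_safe n t \<pi> f r T \<longleftrightarrow>
     (\<forall>F. F \<subseteq> {1..n-1} \<and> card F = f \<longrightarrow>
        measure_pmf.prob (pmf_of_set {1..t}) {k. real (gp_runtime n (\<pi> k) F) \<le> T} \<ge> r)"

definition random_perms :: "nat \<Rightarrow> nat \<Rightarrow> (nat \<Rightarrow> nat \<Rightarrow> nat) pmf" where
  "random_perms n t = Pi_pmf {1..t} id (\<lambda>_. pmf_of_set {\<sigma>. \<sigma> permutes {1..n-1}})"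

end

(* Run from a list l, the algorithm unfolds a binary tree of sublists: a call to a non-faulty
   processor replaces the list by two halves, a failed call only drops the head. If every position
   is good independently with probability p, induction shows that some list is still nonempty after
   k rounds with probability at most |l|^a * (1 - p + 2 p / 2^a)^k, because
   x |-> x^a shrinks by 2^(-a) on each of the two halves. For a uniformly random permutation the
   good positions form a uniformly random set of fixed size p (n - 1); passing to independent
   positions costs at most a factor n, since the mean of a binomial distribution is its mode. With
   a = 3 and the claimed number of rounds a single permutation is bad for a fixed failure pattern
   with probability at most n^(-1/4). A union bound over the at most 2^(n-1) failure patterns and
   the 2^t sets of bad indices leaves 2^(n-1) 2^t n^(-delta t / 4), which is at most exp (-3n) for
   delta = 1 / sqrt (ln n) + sqrt (n / (t ln n)). *)

theory Submission
  imports Defs "HOL-Real_Asymp.Real_Asymp"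
begin

section \<open>Splitting a list into its two halves\<close>

lemma ODD_EVEN_simps [simp]:
  "ODD [] = []" "EVEN [] = []" "ODD (x # xs) = x # EVEN xs" "EVEN (x # xs) = ODD xs"
  by (simp_all add: ODD_def EVEN_def nths_Cons)

lemma length_ODD_EVEN:
  "length (ODD xs) = (length xs + 1) div 2 \<and> length (EVEN xs) = length xs div 2"
  by (induction xs) auto

lemma distinct_ODD_EVEN:
  assumes "distinct xs"
  shows "distinct (ODD xs)" "distinct (EVEN xs)"
  using assms by (simp_all add: ODD_def EVEN_def)

lemma set_ODD_EVEN: "set xs = set (ODD xs) \<union> set (EVEN xs)"
  by (induction xs) auto

lemma disjoint_ODD_EVEN:
  assumes "distinct xs"
  shows "set (ODD xs) \<inter> set (EVEN xs) = {}"
  using assms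
proof (induction xs)
  case (Cons x xs)
  then show ?case using set_ODD_EVEN[of xs] by auto
qed simp

section \<open>Reduction of the distributed run to a recursion on one list\<close>

text \<open>Survival of the tree of sublists, forgetting which processor holds which list.
  \<open>R\<close> stands for the entries whose calls succeed, so randomness will enter only through
  \<open>R\<close>.\<close>

fun alive :: "'a set \<Rightarrow> nat \<Rightarrow> 'a list \<Rightarrow> bool" where
  "alive R m [] = False"
| "alive R 0 (x # xs) = True"
| "alive R (Suc m) (x # xs) =
     (if x \<in> R then alive R m (ODD xs) \<or> alive R m (EVEN xs) else alive R m xs)"

text \<open>The invariant of the rounds that makes callers unique. It keeps all entries in the range
  on which \<pi> is injective.\<close>

definition separated :: "nat \<Rightarrow> config \<Rightarrow> bool" where
  "separated n L \<longleftrightarrow>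
     (\<forall>i<n. distinct (L i) \<and> set (L i) \<subseteq> {1..n-1}) \<and>
     (\<forall>i<n. \<forall>j<n. i \<noteq> j \<longrightarrow> set (L i) \<inter> set (L j) = {})"

text \<open>Removes the definite description from \<open>gp_round\<close>: two callers of
  \<open>k\<close> would have equal heads by injectivity, but their lists are disjoint.\<close>

lemma gp_round_cases:
  assumes sep: "separated n L" and \<pi>: "inj_on \<pi> {1..n-1}" and k: "k < n"
  obtains (called) i where "i < n" "L i \<noteq> []" "\<pi> (hd (L i)) = k" "k \<notin> F"
      "gp_round n \<pi> F L k = EVEN (tl (L i))"
  | (idle) "L k = []" "gp_round n \<pi> F L k = []"
  | (failed) "L k \<noteq> []" "\<pi> (hd (L k)) \<in> F" "gp_round n \<pi> F L k = tl (L k)"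
  | (success) "L k \<noteq> []" "\<pi> (hd (L k)) \<notin> F" "\<pi> (hd (L k)) \<noteq> k" "gp_round n \<pi> F L k = ODD (tl (L k))"
proof (cases "k \<notin> F \<and> (\<exists>i<n. calls \<pi> L i k)")
  case True
  then obtain i where i: "i < n" "calls \<pi> L i k" and "k \<notin> F" by blast
  have "j = i" if j: "j < n" "calls \<pi> L j k" for j
  proof (rule ccontr)
    assume "j \<noteq> i"
    have "hd (L j) \<in> set (L j)" "hd (L i) \<in> set (L i)"
      using i j by (auto simp: calls_def)
    moreover have "set (L j) \<subseteq> {1..n-1}" "set (L i) \<subseteq> {1..n-1}"
      using i j sep by (simp_all add: separated_def)
    moreover have "\<pi> (hd (L j)) = \<pi> (hd (L i))"
      using i j by (simp add: calls_def)
    ultimately have "hd (L j) = hd (L i)" "hd (L i) \<in> set (L i)" "hd (L j) \<in> set (L j)"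
      using \<pi> by (auto dest: inj_onD)
    moreover have "set (L i) \<inter> set (L j) = {}"
      using i j \<open>j \<noteq> i\<close> sep by (simp add: separated_def)
    ultimately show False by auto
  qed
  then have "(THE i. i < n \<and> calls \<pi> L i k) = i"
    using i by blast
  then show thesis
    using i True \<open>k \<notin> F\<close> by (intro called[of i]) (auto simp: gp_round_def calls_def)
next
  case False
  have "gp_round n \<pi> F L k =
      (if L k = [] then [] else if \<pi> (hd (L k)) \<in> F then tl (L k) else ODD (tl (L k)))"
    unfolding gp_round_def if_not_P[OF False] ..
  \<comment> \<open>A non-faulty processor calling itself would be its own caller and fall under the
    first case.\<close>
  moreover have "\<pi> (hd (L k)) \<noteq> k" if "L k \<noteq> []" "\<pi> (hd (L k)) \<notin> F"
    using False k that by (auto simp: calls_def)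
  ultimately show thesis
    using idle failed success by (cases "L k = []"; cases "\<pi> (hd (L k)) \<in> F") simp_all
qed

lemma alive_step:
  assumes "\<not> alive R (Suc m) l" "l \<noteq> []"
  shows "if hd l \<in> R then \<not> alive R m (ODD (tl l)) \<and> \<not> alive R m (EVEN (tl l))
         else \<not> alive R m (tl l)"
  using assms by (cases l) auto

text \<open>Every new list lies in a part of one old list. Parts of different old lists are disjoint
  by the invariant, and parts of the same list at different processors because \<open>ODD\<close>
  and \<open>EVEN\<close> split its tail.\<close>

lemma separated_gp_round:
  assumes sep: "separated n L" and \<pi>: "inj_on \<pi> {1..n-1}"
  shows "separated n (gp_round n \<pi> F L)"
proof -
  let ?L = "gp_round n \<pi> F L"
  \<comment> \<open>the part of the old list of \<open>i\<close> that processor \<open>k\<close> holds after the round\<close>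
  define part where "part i k =
    (if L i = [] then {}
     else if \<pi> (hd (L i)) \<in> F then if k = i then set (tl (L i)) else {}
     else if \<pi> (hd (L i)) = k then set (EVEN (tl (L i)))
     else if k = i then set (ODD (tl (L i))) else {})" for i k
  have dist: "distinct (tl (L i))" if "i < n" for i
    using sep that unfolding separated_def by (auto intro: distinct_tl)
  have "set (tl (L i)) \<subseteq> set (L i)" for i
    by (cases "L i") auto
  then have part: "part i k \<subseteq> set (L i)" for i k
    using set_ODD_EVEN[of "tl (L i)"] by (auto simp: part_def)
  have disj: "part i k \<inter> part i k' = {}" if "i < n" "k \<noteq> k'" for i k k'
    using disjoint_ODD_EVEN[OF dist[OF \<open>i < n\<close>]] that by (auto simp: part_def)
  have origin: "\<exists>i<n. set (?L k) \<subseteq> part i k" if k: "k < n" for k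
    using sep \<pi> k
  proof (cases rule: gp_round_cases[where F = F])
    case (called i)
    then show ?thesis by (intro exI[of _ i]) (simp add: part_def)
  next
    case idle
    then show ?thesis using k by auto
  next
    case failed
    then show ?thesis using k by (intro exI[of _ k]) (simp add: part_def)
  next
    case success
    \<comment> \<open>The inequality supplied by this case rules out the \<open>EVEN\<close> branch
      of \<open>part k k\<close>.\<close>
    then show ?thesis using k by (intro exI[of _ k]) (simp add: part_def)
  qed
  show ?thesis
    unfolding separated_def
  proof (intro conjI allI impI)
    fix k assume k: "k < n"
    show "distinct (?L k)"
      using sep \<pi> k
      by (cases rule: gp_round_cases[where F = F]) (use k in \<open>auto intro: distinct_ODD_EVEN dist\<close>)
    obtain i where "i < n" "set (?L k) \<subseteq> part i k" using origin[OF k] by blast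
    moreover from this have "set (L i) \<subseteq> {1..n-1}" using sep by (simp add: separated_def)
    ultimately show "set (?L k) \<subseteq> {1..n-1}" using part[of i k] by blast
    fix k' assume k': "k' < n" "k \<noteq> k'"
    obtain j where j: "j < n" "set (?L k') \<subseteq> part j k'" using origin[OF k'(1)] by blast
    have "part i k \<inter> part j k' = {}"
    proof (cases "i = j")
      case True
      then show ?thesis using disj[OF \<open>i < n\<close> k'(2)] by simp
    next
      case False
      then have "set (L i) \<inter> set (L j) = {}"
        using sep \<open>i < n\<close> j(1) by (simp add: separated_def)
      then show ?thesis using part[of i k] part[of j k'] by blast
    qed
    then show "set (?L k) \<inter> set (?L k') = {}"
      using j(2) \<open>set (?L k) \<subseteq> part i k\<close> by blast
  qed
qed

text \<open>A new list is empty or a child, in the recursion of \<open>alive\<close>, of some old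
  list, so it has died one round earlier. The good entries are the preimage under \<pi> of the
  non-faulty processors, since lists contain arguments of \<pi>.\<close>

lemma gp_round_not_alive:
  assumes sep: "separated n L" and \<pi>: "\<pi> permutes {1..n-1}"
    and dead: "\<And>i. i < n \<Longrightarrow> \<not> alive {x \<in> {1..n-1}. \<pi> x \<notin> F} (Suc m) (L i)" and k: "k < n"
  shows "\<not> alive {x \<in> {1..n-1}. \<pi> x \<notin> F} m (gp_round n \<pi> F L k)"
proof -
  let ?R = "{x \<in> {1..n-1}. \<pi> x \<notin> F}"
  have hd: "hd (L i) \<in> {1..n-1}" if "i < n" "L i \<noteq> []" for i
  proof -
    have "set (L i) \<subseteq> {1..n-1}" using that sep by (simp add: separated_def)
    then show ?thesis using that by (meson hd_in_set subsetD)
  qed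
  show ?thesis
    using sep permutes_inj_on[OF \<pi>] k
  proof (cases rule: gp_round_cases[where F = F])
    case (called i)
    then have "hd (L i) \<in> ?R" using hd by simp
    then show ?thesis using alive_step[OF dead[of i]] called by simp
  next
    case success
    then have "hd (L k) \<in> ?R" using hd k by simp
    then show ?thesis using alive_step[OF dead[OF k]] success by simp
  next
    case failed
    then have "hd (L k) \<notin> ?R" by simp
    then show ?thesis using alive_step[OF dead[OF k]] failed by simp
  qed simp
qed

text \<open>\<open>alive\<close> consumes rounds from the front, so the induction peels off the
  first round and generalizes over the starting configuration.\<close>

lemma gp_rounds_terminate:
  assumes "separated n L" "\<pi> permutes {1..n-1}"
    "\<And>i. i < n \<Longrightarrow> \<not> alive {x \<in> {1..n-1}. \<pi> x \<notin> F} m (L i)" "i < n"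
  shows "(gp_round n \<pi> F ^^ m) L i = []"
  using assms
proof (induction m arbitrary: L)
  case 0
  have "\<not> alive {x \<in> {1..n-1}. \<pi> x \<notin> F} 0 (L i)" by (rule 0(3)) (fact 0)
  then show ?case by (cases "L i") auto
next
  case (Suc m)
  have "(gp_round n \<pi> F ^^ m) (gp_round n \<pi> F L) i = []"
  proof (rule Suc.IH)
    show "separated n (gp_round n \<pi> F L)"
      using Suc.prems by (intro separated_gp_round permutes_inj_on)
    show "\<not> alive {x \<in> {1..n-1}. \<pi> x \<notin> F} m (gp_round n \<pi> F L j)" if "j < n" for j
      using Suc.prems that by (intro gp_round_not_alive)
  qed (fact Suc.prems)+
  then show ?case by (simp add: funpow_swap1)
qed

text \<open>The interface to the probabilistic part: only the fate of the initial list of processor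
  0 matters from here on.\<close>

lemma gp_runtime_le:
  assumes "\<pi> permutes {1..n-1}" "\<not> alive {x \<in> {1..n-1}. \<pi> x \<notin> F} m [1..<n]"
  shows "gp_runtime n \<pi> F \<le> m"
proof -
  have "separated n (gp_init n)"
    by (auto simp: separated_def gp_init_def)
  then have "\<forall>i<n. gp_config n \<pi> F m i = []"
    unfolding gp_config_def using assms
    by (intro allI impI gp_rounds_terminate) (auto simp: gp_init_def)
  then show ?thesis
    unfolding gp_runtime_def by (rule Least_le)
qed

section \<open>Survival when positions are good independently\<close>

text \<open>For \<open>R\<close> inside \<open>M\<close>, the probability that \<open>R\<close> is
  exactly the set of good elements when each element of \<open>M\<close> is good independently with
  probability \<open>p\<close>. Expectations thus become finite sums over
  \<open>Pow M\<close>.\<close>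

definition pattern_weight :: "real \<Rightarrow> 'a set \<Rightarrow> 'a set \<Rightarrow> real" where
  "pattern_weight p M R = p ^ card R * (1 - p) ^ card (M - R)"

text \<open>Conditioning on the coin of \<open>x\<close>: the first summand is the good outcome, the
  second the bad one.\<close>

lemma sum_pattern_weight_insert:
  assumes "finite M" "x \<notin> M"
  shows "(\<Sum>R\<in>Pow (insert x M). pattern_weight p (insert x M) R * \<phi> R) =
    p * (\<Sum>R\<in>Pow M. pattern_weight p M R * \<phi> (insert x R)) +
    (1 - p) * (\<Sum>R\<in>Pow M. pattern_weight p M R * \<phi> R)"
proof -
  have "(\<Sum>R\<in>Pow (insert x M). pattern_weight p (insert x M) R * \<phi> R) =
      (\<Sum>R\<in>Pow M. pattern_weight p (insert x M) R * \<phi> R) +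
      (\<Sum>R\<in>insert x ` Pow M. pattern_weight p (insert x M) R * \<phi> R)"
    unfolding Pow_insert using assms by (intro sum.union_disjoint) auto
  also have "(\<Sum>R\<in>insert x ` Pow M. pattern_weight p (insert x M) R * \<phi> R) =
      (\<Sum>R\<in>Pow M. pattern_weight p (insert x M) (insert x R) * \<phi> (insert x R))"
    using assms by (subst sum.reindex) (auto simp: inj_on_def)
  also have "\<dots> = p * (\<Sum>R\<in>Pow M. pattern_weight p M R * \<phi> (insert x R))"
    unfolding sum_distrib_left
  proof (rule sum.cong)
    fix R assume "R \<in> Pow M"
    then have "finite R" "x \<notin> R" "insert x M - insert x R = M - R"
      using assms by (auto intro: finite_subset)
    then show "pattern_weight p (insert x M) (insert x R) * \<phi> (insert x R) =
        p * (pattern_weight p M R * \<phi> (insert x R))"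
      by (simp add: pattern_weight_def)
  qed simp
  also have "(\<Sum>R\<in>Pow M. pattern_weight p (insert x M) R * \<phi> R) =
      (1 - p) * (\<Sum>R\<in>Pow M. pattern_weight p M R * \<phi> R)"
    unfolding sum_distrib_left
  proof (rule sum.cong)
    fix R assume "R \<in> Pow M"
    then have "insert x M - R = insert x (M - R)" "finite (M - R)" "x \<notin> M - R"
      using assms by auto
    then show "pattern_weight p (insert x M) R * \<phi> R = (1 - p) * (pattern_weight p M R * \<phi> R)"
      by (simp add: pattern_weight_def)
  qed simp
  finally show ?thesis by simp
qed

lemma sum_pattern_weight:
  assumes "finite M"
  shows "(\<Sum>R\<in>Pow M. pattern_weight p M R) = 1"
  using assms
proof (induction M rule: finite_induct)
  case empty
  then show ?case by (simp add: pattern_weight_def)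
next
  case (insert x M)
  then show ?case using sum_pattern_weight_insert[of M x p "\<lambda>_. 1"] by simp
qed

text \<open>The recursion tests only entries of the list, so once the coin of the head is split off,
  the sublists depend on the remaining coins alone.\<close>

lemma alive_insert:
  assumes "x \<notin> set l"
  shows "alive (insert x R) m l = alive R m l"
  using assms
proof (induction R m l rule: alive.induct)
  case (3 R m y ys)
  then have "x \<notin> set (ODD ys)" "x \<notin> set (EVEN ys)"
    using set_ODD_EVEN[of ys] by auto
  with 3 show ?case by auto
qed auto

text \<open>Condition on the head. If it is good, a union bound over two lists of at most half the
  length gives the factor \<open>2 / 2 ^ a\<close>; if it is bad, the tail is no longer than
  \<open>l\<close>. Averaging yields one factor \<open>1 - p + p * 2 / 2 ^ a\<close> per
  round.\<close>

lemma sum_pattern_weight_alive_le: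
  fixes p :: real
  assumes p: "0 \<le> p" "p \<le> 1" and "finite M" "distinct l" "set l \<subseteq> M"
  shows "(\<Sum>R\<in>Pow M. pattern_weight p M R * of_bool (alive R m l))
      \<le> real (length l) ^ a * (1 - p + p * 2 / 2 ^ a) ^ m"
  using assms(3-5)
proof (induction m arbitrary: M l)
  case 0
  show ?case
  proof (cases l)
    case (Cons x xs)
    then have "(\<Sum>R\<in>Pow M. pattern_weight p M R * of_bool (alive R 0 l)) = 1"
      using sum_pattern_weight[OF 0(1)] by simp
    also have "1 \<le> real (length l) ^ a"
      using Cons by (intro one_le_power) auto
    finally show ?thesis by simp
  qed auto
next
  case (Suc m)
  define \<beta> where "\<beta> = 1 - p + p * 2 / 2 ^ a"
  have \<beta>: "\<beta> \<ge> 0" using p by (auto simp: \<beta>_def)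
  show ?case
  proof (cases l)
    case Nil
    then show ?thesis using \<beta> by (simp add: \<beta>_def)
  next
    case (Cons x xs)
    define M' where "M' = M - {x}"
    let ?E = "\<lambda>l'. \<Sum>R\<in>Pow M'. pattern_weight p M' R * of_bool (alive R m l')"
    have M: "M = insert x M'" "finite M'" "x \<notin> M'"
      using Suc.prems Cons by (auto simp: M'_def)
    have xs: "distinct xs" "set xs \<subseteq> M'" "x \<notin> set xs"
      using Suc.prems Cons by (auto simp: M'_def)
    then have halves: "x \<notin> set (ODD xs)" "x \<notin> set (EVEN xs)"
      "set (ODD xs) \<subseteq> M'" "set (EVEN xs) \<subseteq> M'"
      using set_ODD_EVEN[of xs] by auto
    \<comment> \<open>The deleted head compensates for rounding up: \<open>ODD xs\<close> has
      \<open>(length xs + 1) div 2\<close> entries and \<open>l\<close> has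
      \<open>length xs + 1\<close>.\<close>
    have len: "real (length (ODD xs)) \<le> real (length l) / 2"
      "real (length (EVEN xs)) \<le> real (length l) / 2"
      using length_ODD_EVEN[of xs] Cons by auto
    have IH: "?E l' \<le> c ^ a * \<beta> ^ m"
      if "distinct l'" "set l' \<subseteq> M'" "real (length l') \<le> c" for l' c
    proof -
      have "?E l' \<le> real (length l') ^ a * \<beta> ^ m"
        unfolding \<beta>_def by (rule Suc.IH) (use M that in auto)
      also have "\<dots> \<le> c ^ a * \<beta> ^ m"
        using \<beta> that by (intro mult_right_mono power_mono) auto
      finally show ?thesis .
    qed
    have nonneg: "pattern_weight p M' R \<ge> 0" for R
      using p by (simp add: pattern_weight_def)
    have split: "(\<Sum>R\<in>Pow M. pattern_weight p M R * of_bool (alive R (Suc m) l)) =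
        p * (\<Sum>R\<in>Pow M'. pattern_weight p M' R *
               of_bool (alive R m (ODD xs) \<or> alive R m (EVEN xs))) + (1 - p) * ?E xs"
    proof -
      have "(\<Sum>R\<in>Pow M'. pattern_weight p M' R * of_bool (alive R (Suc m) l)) = ?E xs"
        using M(3) by (intro sum.cong) (auto simp: Cons)
      then show ?thesis
        unfolding M(1) sum_pattern_weight_insert[OF M(2,3)]
        by (simp add: Cons alive_insert halves)
    qed
    have "(\<Sum>R\<in>Pow M'. pattern_weight p M' R *
        of_bool (alive R m (ODD xs) \<or> alive R m (EVEN xs))) \<le> ?E (ODD xs) + ?E (EVEN xs)"
      unfolding sum.distrib[symmetric] distrib_left[symmetric]
      by (intro sum_mono mult_left_mono nonneg) auto
    also have "\<dots> \<le> (real (length l) / 2) ^ a * \<beta> ^ m + (real (length l) / 2) ^ a * \<beta> ^ m"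
      using xs halves len by (intro add_mono IH distinct_ODD_EVEN)
    finally have good: "(\<Sum>R\<in>Pow M'. pattern_weight p M' R *
        of_bool (alive R m (ODD xs) \<or> alive R m (EVEN xs))) \<le> 2 * ((real (length l) / 2) ^ a * \<beta> ^ m)"
      by (simp add: mult_ac)
    have bad: "?E xs \<le> real (length l) ^ a * \<beta> ^ m"
      using xs by (intro IH) (auto simp: Cons)
    have "(\<Sum>R\<in>Pow M. pattern_weight p M R * of_bool (alive R (Suc m) l)) \<le>
        p * (2 * ((real (length l) / 2) ^ a * \<beta> ^ m)) + (1 - p) * (real (length l) ^ a * \<beta> ^ m)"
      unfolding split using p by (intro add_mono mult_left_mono good bad) auto
    also have "\<dots> = real (length l) ^ a * \<beta> ^ m * \<beta>"
    proof -
      have "p * (2 * ((c / 2) ^ a * B)) + (1 - p) * (c ^ a * B) = c ^ a * B * (1 - p + p * 2 / 2 ^ a)"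
        for c B :: real
        by (simp add: power_divide algebra_simps)
      then show ?thesis by (simp only: \<beta>_def)
    qed
    also have "\<dots> = real (length l) ^ a * \<beta> ^ Suc m"
      by simp
    finally show ?thesis unfolding \<beta>_def .
  qed
qed

section \<open>From independent positions to good sets of fixed size\<close>

text \<open>Up to normalization these are Poisson weights with mean \<open>g\<close>. The ratio of
  consecutive terms is \<open>g / (k + 1)\<close>, so they increase up to \<open>k = g\<close> and
  do not increase afterwards.\<close>

lemma power_div_fact_le:
  fixes g k :: nat
  shows "real g ^ k / fact k \<le> real g ^ g / fact g"
proof -
  have Suc: "real g ^ Suc k / fact (Suc k) = real g ^ k / fact k * (real g / real (Suc k))" for k
    by (simp add: field_simps)
  show ?thesis
  proof (cases "k \<le> g")
    case True
    then show ?thesis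
    proof (induction k rule: inc_induct)
      case (step k)
      have "real g ^ k / fact k * 1 \<le> real g ^ k / fact k * (real g / real (Suc k))"
        using step(2) by (intro mult_left_mono) auto
      with step(3) show ?case by (simp only: Suc mult_1_right)
    qed simp
  next
    case False
    then have "g \<le> k" by simp
    then show ?thesis
    proof (induction k rule: dec_induct)
      case (step k)
      have "real g ^ k / fact k * (real g / real (Suc k)) \<le> real g ^ k / fact k * 1"
        using step(1) by (intro mult_left_mono) auto
      with step(3) show ?case by (simp only: Suc mult_1_right)
    qed simp
  qed
qed

text \<open>Up to a common factor, each binomial term is a product of two Poisson weights with means
  \<open>g\<close> and \<open>f\<close>, both maximal at \<open>k = g\<close>. So each of the
  \<open>m + 1\<close> terms, which sum to 1, is at most the one at the mean.\<close>

lemma binomial_mean_prob_ge: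
  fixes f g m :: nat
  assumes m: "m = f + g" "m > 0" and p: "p = real g / real m"
  shows "1 \<le> real (m + 1) * (real (m choose g) * p ^ g * (1 - p) ^ f)"
proof -
  have q: "1 - p = real f / real m" using m by (simp add: p diff_divide_eq_iff flip: of_nat_add)
  have *: "real (m choose k) * p ^ k * (1 - p) ^ (m - k) =
      fact m / real m ^ m * ((real g ^ k / fact k) * (real f ^ (m - k) / fact (m - k)))"
    if "k \<le> m" for k
  proof -
    have "real m ^ m = real m ^ k * real m ^ (m - k)"
      using that by (simp flip: power_add)
    then show ?thesis
      using that unfolding q by (simp add: binomial_fact p power_divide mult_ac)
  qed
  have "1 = (p + (1 - p)) ^ m" by simp
  also have "\<dots> = (\<Sum>k\<le>m. real (m choose k) * p ^ k * (1 - p) ^ (m - k))"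
    by (rule binomial_ring)
  also have "\<dots> \<le> (\<Sum>k\<le>m. real (m choose g) * p ^ g * (1 - p) ^ f)"
  proof (rule sum_mono)
    fix k assume k: "k \<in> {..m}"
    have "(real g ^ k / fact k) * (real f ^ (m - k) / fact (m - k)) \<le>
        (real g ^ g / fact g) * (real f ^ f / fact f)"
      by (intro mult_mono power_div_fact_le) auto
    then have "fact m / real m ^ m * ((real g ^ k / fact k) * (real f ^ (m - k) / fact (m - k)))
       \<le> fact m / real m ^ m * ((real g ^ g / fact g) * (real f ^ f / fact f))"
      by (intro mult_left_mono) auto
    then show "real (m choose k) * p ^ k * (1 - p) ^ (m - k) \<le> real (m choose g) * p ^ g * (1 - p) ^ f"
      using *[of k] *[of g] k m(1) by (simp only: atMost_iff le_add2 diff_add_inverse2)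
  qed
  finally show ?thesis by simp
qed

text \<open>All sets of size \<open>g\<close> have the same weight \<open>w\<close>, so their
  contribution to the independent bound is their number times \<open>w\<close>. The mode estimate
  turns \<open>1 / w\<close> into at most \<open>m + 1\<close> times the binomial
  coefficient.\<close>

lemma card_alive_le:
  fixes M :: "'a set" and f g m :: nat
  assumes M: "finite M" "card M = m" "m > 0" "m = f + g" and l: "distinct l" "set l \<subseteq> M"
    and p: "p = real g / real m"
  shows "real (card {R. R \<subseteq> M \<and> card R = g \<and> alive R k l}) \<le>
    real (m choose g) * (real (m + 1) * (real (length l) ^ a * (1 - p + p * 2 / 2 ^ a) ^ k))"
proof -
  let ?B = "{R. R \<subseteq> M \<and> card R = g \<and> alive R k l}"
  define w where "w = p ^ g * (1 - p) ^ f"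
  define b where "b = real (length l) ^ a * (1 - p + p * 2 / 2 ^ a) ^ k"
  have p01: "0 \<le> p" "p \<le> 1" using p M by auto
  have pos: "pattern_weight p M R \<ge> 0" for R
    using p01 by (simp add: pattern_weight_def)
  have "real (card ?B) * w = (\<Sum>R\<in>?B. pattern_weight p M R * of_bool (alive R k l))"
  proof -
    have "pattern_weight p M R * of_bool (alive R k l) = w" if "R \<in> ?B" for R
    proof -
      have "finite R" using that M by (auto intro: finite_subset)
      then show ?thesis using that M by (simp add: pattern_weight_def w_def card_Diff_subset)
    qed
    then show ?thesis by simp
  qed
  also have "\<dots> \<le> (\<Sum>R\<in>Pow M. pattern_weight p M R * of_bool (alive R k l))"
    using M pos by (intro sum_mono2) auto
  also have "\<dots> \<le> b"
    unfolding b_def by (intro sum_pattern_weight_alive_le p01 M l)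
  finally have le: "real (card ?B) * w \<le> b" .
  have mode: "1 \<le> real (m + 1) * (real (m choose g) * w)"
    using binomial_mean_prob_ge[OF M(4,3) p] by (simp add: w_def mult.assoc)
  have "real (card ?B) \<le> real (card ?B) * (real (m + 1) * (real (m choose g) * w))"
    using mult_left_mono[OF mode, of "real (card ?B)"] by simp
  also have "\<dots> = real (m choose g) * (real (m + 1) * (real (card ?B) * w))"
    by (simp add: mult_ac)
  also have "\<dots> \<le> real (m choose g) * (real (m + 1) * b)"
    by (intro mult_left_mono le) auto
  finally show ?thesis by (simp add: b_def)
qed

section \<open>From random permutations to random subsets\<close>

text \<open>Composition on the right with a permutation of \<open>M\<close> taking \<open>R'\<close>
  onto \<open>R\<close> injects the first set into the second.\<close>

lemma card_permutes_preimage_le: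
  assumes M: "finite M" and R: "R \<subseteq> M" "R' \<subseteq> M" "card R = card R'"
  shows "card {\<sigma>. \<sigma> permutes M \<and> {x \<in> M. \<sigma> x \<notin> F} = R}
      \<le> card {\<sigma>. \<sigma> permutes M \<and> {x \<in> M. \<sigma> x \<notin> F} = R'}"
proof -
  have fin: "finite R" "finite R'"
    using M R by (auto intro: finite_subset)
  then obtain g where g: "bij_betw g R' R"
    using R finite_same_card_bij by metis
  have "card (M - R') = card (M - R)"
    using M R fin by (simp add: card_Diff_subset)
  then obtain h where h: "bij_betw h (M - R') (M - R)"
    using M finite_same_card_bij by (metis finite_Diff)
  define \<tau> where "\<tau> x = (if x \<in> R' then g x else if x \<in> M then h x else x)" for x
  have "bij_betw (\<lambda>x. if x \<in> R' then g x else h x) (R' \<union> (M - R')) (R \<union> (M - R))"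
    by (rule bij_betw_disjoint_Un[OF g h]) auto
  moreover have "R' \<union> (M - R') = M" "R \<union> (M - R) = M" using R by auto
  ultimately have "bij_betw (\<lambda>x. if x \<in> R' then g x else h x) M M" by simp
  then have "bij_betw \<tau> M M"
    by (rule bij_betw_cong[THEN iffD1, rotated]) (auto simp: \<tau>_def)
  then have \<tau>: "\<tau> permutes M"
    using R by (intro bij_imp_permutes) (auto simp: \<tau>_def)
  have \<tau>R: "\<tau> x \<in> R \<longleftrightarrow> x \<in> R'" if "x \<in> M" for x
    using g h that by (auto simp: \<tau>_def bij_betw_def)
  show ?thesis
  proof (rule card_inj_on_le)
    show "inj_on (\<lambda>\<sigma>. \<sigma> \<circ> \<tau>) {\<sigma>. \<sigma> permutes M \<and> {x \<in> M. \<sigma> x \<notin> F} = R}"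
      using permutes_surj[OF \<tau>] by (auto simp: inj_on_def fun_eq_iff) (metis surjD)
    show "(\<lambda>\<sigma>. \<sigma> \<circ> \<tau>) ` {\<sigma>. \<sigma> permutes M \<and> {x \<in> M. \<sigma> x \<notin> F} = R}
        \<subseteq> {\<sigma>. \<sigma> permutes M \<and> {x \<in> M. \<sigma> x \<notin> F} = R'}"
    proof safe
      fix \<sigma> assume \<sigma>: "\<sigma> permutes M" "R = {x \<in> M. \<sigma> x \<notin> F}"
      show "\<sigma> \<circ> \<tau> permutes M" using \<tau> \<sigma>(1) by (rule permutes_compose)
      fix x
      { assume "x \<in> M" "(\<sigma> \<circ> \<tau>) x \<notin> F"
        then show "x \<in> R'" using \<tau>R[of x] \<sigma>(2) permutes_in_image[OF \<tau>, of x] by simp }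
      assume x: "x \<in> R'"
      then show "x \<in> M" using R by auto
      assume "(\<sigma> \<circ> \<tau>) x \<in> F"
      then show False using \<tau>R[of x] x \<sigma>(2) R by auto
    qed
    show "finite {\<sigma>. \<sigma> permutes M \<and> {x \<in> M. \<sigma> x \<notin> F} = R'}"
      by (rule finite_subset[OF _ finite_permutations[OF M]]) auto
  qed
qed

text \<open>The good set of a uniform permutation is a uniform subset of its size, because all
  fibres are equally large. The statement is multiplied out to stay within the natural
  numbers.\<close>

lemma card_permutes_preimage:
  assumes M: "finite M" and F: "F \<subseteq> M"
  shows "card {\<sigma>. \<sigma> permutes M \<and> Q {x \<in> M. \<sigma> x \<notin> F}} * (card M choose (card M - card F)) =
    fact (card M) * card {R. R \<subseteq> M \<and> card R = card M - card F \<and> Q R}"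
proof -
  let ?g = "card M - card F"
  define fibre where "fibre R = {\<sigma>. \<sigma> permutes M \<and> {x \<in> M. \<sigma> x \<notin> F} = R}" for R
  define N where "N = card (fibre (M - F))"
  have finF: "finite F" using M F by (rule finite_subset[rotated])
  have N: "card (fibre R) = N" if "R \<subseteq> M" "card R = ?g" for R
  proof -
    have c: "card R = card (M - F)" using that M F finF by (simp add: card_Diff_subset)
    show ?thesis unfolding N_def fibre_def
      by (intro antisym card_permutes_preimage_le M) (use that c in auto)
  qed
  have pre: "card {x \<in> M. \<sigma> x \<notin> F} = ?g" if "\<sigma> permutes M" for \<sigma>
  proof -
    have "card {x \<in> M. \<sigma> x \<notin> F} = card (\<sigma> ` {x \<in> M. \<sigma> x \<notin> F})"
      using permutes_inj_on[OF that] by (simp add: card_image)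
    also have "\<sigma> ` {x \<in> M. \<sigma> x \<notin> F} = M - F"
      using permutes_image[OF that] by auto
    finally show ?thesis using M F finF by (simp add: card_Diff_subset)
  qed
  have count: "card {\<sigma>. \<sigma> permutes M \<and> Q {x \<in> M. \<sigma> x \<notin> F}} =
      card {R. R \<subseteq> M \<and> card R = ?g \<and> Q R} * N" for Q
  proof -
    have "{\<sigma>. \<sigma> permutes M \<and> Q {x \<in> M. \<sigma> x \<notin> F}} =
        (\<Union>R\<in>{R. R \<subseteq> M \<and> card R = ?g \<and> Q R}. fibre R)"
      using pre by (auto simp: fibre_def)
    also have "card \<dots> = (\<Sum>R\<in>{R. R \<subseteq> M \<and> card R = ?g \<and> Q R}. card (fibre R))"
    proof (rule card_UN_disjoint)
      show "finite {R. R \<subseteq> M \<and> card R = ?g \<and> Q R}"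
        using M by simp
      show "\<forall>R\<in>{R. R \<subseteq> M \<and> card R = ?g \<and> Q R}. finite (fibre R)"
        unfolding fibre_def using finite_permutations[OF M] by auto
    qed (auto simp: fibre_def)
    also have "\<dots> = card {R. R \<subseteq> M \<and> card R = ?g \<and> Q R} * N"
      using N by simp
    finally show ?thesis .
  qed
  \<comment> \<open>The trivial predicate counts all permutations and so determines the fibre size
    \<open>N\<close>.\<close>
  have "fact (card M) = (card M choose ?g) * N"
    using count[of "\<lambda>_. True"] card_permutations[OF refl M] n_subsets[OF M, of ?g] by simp
  then show ?thesis using count[of Q] by simp
qed

text \<open>A long run forces \<open>[1..<n]\<close> to be alive after \<open>k\<close> rounds, an
  event depending only on the good set. The factor \<open>real n\<close> is the price
  \<open>m + 1\<close> of passing to independent positions.\<close>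

lemma prob_gp_runtime_gt_le:
  fixes n k a :: nat and T p :: real
  assumes n: "n \<ge> 2" and F: "F \<subseteq> {1..n-1}" and k: "real k \<le> T"
    and p: "p = 1 - real (card F) / (real n - 1)"
  shows "measure_pmf.prob (pmf_of_set {\<sigma>. \<sigma> permutes {1..n-1}}) {\<sigma>. T < real (gp_runtime n \<sigma> F)}
    \<le> real n * (real (n - 1) ^ a * (1 - p + p * 2 / 2 ^ a) ^ k)"
proof -
  define m where "m = n - 1"
  define g where "g = m - card F"
  define b where "b = real n * (real m ^ a * (1 - p + p * 2 / 2 ^ a) ^ k)"
  have m: "m > 0" "real n - 1 = real m" using n by (auto simp: m_def)
  have F_le: "card F \<le> m" using card_mono[OF _ F] by (simp add: m_def)
  have pg: "p = real g / real m"
    using m F_le by (simp add: p g_def diff_divide_distrib)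
  let ?P = "{\<sigma>. \<sigma> permutes {1..m}}"
  let ?A = "{\<sigma>. \<sigma> permutes {1..m} \<and> alive {x \<in> {1..m}. \<sigma> x \<notin> F} k [1..<n]}"
  have P: "finite ?P" "card ?P = fact m"
    using finite_permutations[of "{1..m}"] card_permutations[of "{1..m}" m] by auto
  have ne: "?P \<noteq> {}" using permutes_id by blast
  have "?P \<inter> {\<sigma>. T < real (gp_runtime n \<sigma> F)} \<subseteq> ?A"
  proof safe
    fix \<sigma> assume \<sigma>: "\<sigma> permutes {1..m}" "T < real (gp_runtime n \<sigma> F)"
    show "alive {x \<in> {1..m}. \<sigma> x \<notin> F} k [1..<n]"
    proof (rule ccontr)
      assume "\<not> alive {x \<in> {1..m}. \<sigma> x \<notin> F} k [1..<n]"
      then have "gp_runtime n \<sigma> F \<le> k"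
        using \<sigma>(1) by (intro gp_runtime_le) (simp_all add: m_def)
      then show False using \<sigma>(2) k by linarith
    qed
  qed
  then have le: "card (?P \<inter> {\<sigma>. T < real (gp_runtime n \<sigma> F)}) \<le> card ?A"
    using P(1) by (intro card_mono) (auto intro: finite_subset)
  have "real (card {R. R \<subseteq> {1..m} \<and> card R = g \<and> alive R k [1..<n]}) \<le>
      real (m choose g) * (real (m + 1) * (real (length [1..<n]) ^ a * (1 - p + p * 2 / 2 ^ a) ^ k))"
    using m F_le pg by (intro card_alive_le[where f = "card F"]) (auto simp: g_def)
  then have sub: "real (card {R. R \<subseteq> {1..m} \<and> card R = g \<and> alive R k [1..<n]}) \<le>
      real (m choose g) * b"
    using n by (simp only: b_def m_def length_upt le_add_diff_inverse2)
  have eq: "card ?A * (m choose g) =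
      fact m * card {R. R \<subseteq> {1..m} \<and> card R = g \<and> alive R k [1..<n]}"
    using card_permutes_preimage[of "{1..m}" F "\<lambda>R. alive R k [1..<n]"] F
    by (simp add: g_def m_def)
  have "real (card ?A) * real (m choose g) =
      fact m * real (card {R. R \<subseteq> {1..m} \<and> card R = g \<and> alive R k [1..<n]})"
    using arg_cong[OF eq, of real] by simp
  also have "\<dots> \<le> fact m * (real (m choose g) * b)"
    using sub by (intro mult_left_mono) auto
  finally have "real (card ?A) * real (m choose g) \<le> (fact m * b) * real (m choose g)"
    by (simp add: mult_ac)
  then have "real (card ?A) \<le> fact m * b"
    by (rule mult_right_le_imp_le) (simp add: g_def)
  then have "real (card (?P \<inter> {\<sigma>. T < real (gp_runtime n \<sigma> F)})) \<le> fact m * b"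
    using le by linarith
  then have "real (card (?P \<inter> {\<sigma>. T < real (gp_runtime n \<sigma> F)})) / fact m \<le> b"
    by (simp add: divide_le_eq mult.commute)
  then show ?thesis
    unfolding m_def[symmetric] measure_pmf_of_set[OF ne P(1)] P(2) b_def by simp
qed

section \<open>Union bounds over index sets and failure patterns\<close>

text \<open>A union bound over candidate sets \<open>S\<close> of bad indices. Independence gives
  \<open>q ^ card S\<close> for each of them, which is at most \<open>q powr s\<close> as
  \<open>q\<close> does not exceed 1.\<close>

lemma prob_Pi_pmf_many_le:
  fixes q s :: real
  assumes I: "finite I" and q: "measure_pmf.prob D B \<le> q" "0 < q" "q \<le> 1"
  shows "measure_pmf.prob (Pi_pmf I d (\<lambda>_. D)) {\<pi>. s < real (card {i \<in> I. \<pi> i \<in> B})}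
    \<le> 2 ^ card I * q powr s"
proof -
  let ?P = "Pi_pmf I d (\<lambda>_. D)"
  let ?S = "{S \<in> Pow I. s < real (card S)}"
  \<comment> \<open>Indices outside \<open>S\<close> are unconstrained, so each event is a product
    set and the events may overlap.\<close>
  let ?E = "\<lambda>S. Pi I (\<lambda>i. if i \<in> S then B else UNIV)"
  have fin: "finite ?S" using I by simp
  have "measure_pmf.prob ?P {\<pi>. s < real (card {i \<in> I. \<pi> i \<in> B})}
      \<le> measure_pmf.prob ?P (\<Union>S\<in>?S. ?E S)"
  proof (intro measure_pmf.finite_measure_mono subsetI)
    fix \<pi> assume "\<pi> \<in> {\<pi>. s < real (card {i \<in> I. \<pi> i \<in> B})}"
    then show "\<pi> \<in> (\<Union>S\<in>?S. ?E S)"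
      by (intro UN_I[of "{i \<in> I. \<pi> i \<in> B}"]) auto
  qed simp
  also have "\<dots> \<le> (\<Sum>S\<in>?S. measure_pmf.prob ?P (?E S))"
    using fin by (intro measure_UNION_le) auto
  also have "\<dots> \<le> (\<Sum>S\<in>?S. q powr s)"
  proof (rule sum_mono)
    fix S assume S: "S \<in> ?S"
    have "measure_pmf.prob ?P (?E S) =
        (\<Prod>i\<in>I. measure_pmf.prob D (if i \<in> S then B else UNIV))"
      using I by (rule measure_Pi_pmf_Pi)
    also have "\<dots> = (\<Prod>i\<in>I. if i \<in> S then measure_pmf.prob D B else 1)"
      by (intro prod.cong) auto
    also have "\<dots> = (\<Prod>i\<in>S. measure_pmf.prob D B)"
      using I S by (subst prod.If_cases) (auto simp: Int_absorb1 Int_absorb2)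
    also have "\<dots> \<le> q ^ card S"
      using q by (simp add: power_mono)
    also have "\<dots> = q powr real (card S)"
      using q by (simp add: powr_realpow)
    also have "\<dots> \<le> q powr s"
      using q S by (intro powr_mono') auto
    finally show "measure_pmf.prob ?P (?E S) \<le> q powr s" .
  qed
  also have "\<dots> = real (card ?S) * q powr s" by simp
  also have "\<dots> \<le> real (card (Pow I)) * q powr s"
    using I by (intro mult_right_mono of_nat_mono card_mono) auto
  finally show ?thesis using I by (simp add: card_Pow)
qed

text \<open>Failure of safety means that some failure pattern has more than a \<delta> fraction of
  bad indices. There are at most \<open>2 ^ (n - 1)\<close> patterns, whatever \<open>f\<close>
  is.\<close>

lemma prob_not_gp_safe_le:
  fixes n t f k a :: nat and T p q \<delta> :: real
  assumes n: "n \<ge> 2" and t: "t > 0" and k: "real k \<le> T"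
    and p: "p = 1 - real f / (real n - 1)"
    and q: "real n * (real (n - 1) ^ a * (1 - p + p * 2 / 2 ^ a) ^ k) \<le> q" "0 < q" "q \<le> 1"
  shows "1 - measure_pmf.prob (random_perms n t) {\<pi>. gp_safe n t \<pi> f (1 - \<delta>) T}
    \<le> 2 ^ (n - 1) * (2 ^ t * q powr (\<delta> * real t))"
proof -
  let ?D = "pmf_of_set {\<sigma>. \<sigma> permutes {1..n-1}}"
  let ?\<F> = "{F. F \<subseteq> {1..n-1} \<and> card F = f}"
  let ?B = "\<lambda>F. {\<sigma>. T < real (gp_runtime n \<sigma> F)}"
  let ?E = "\<lambda>F. {\<pi>. \<delta> * real t < real (card {i \<in> {1..t}. \<pi> i \<in> ?B F})}"
  have fin: "finite ?\<F>" by simp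
  have "1 - measure_pmf.prob (random_perms n t) {\<pi>. gp_safe n t \<pi> f (1 - \<delta>) T} =
      measure_pmf.prob (random_perms n t) (- {\<pi>. gp_safe n t \<pi> f (1 - \<delta>) T})"
    using measure_pmf.prob_compl[of "{\<pi>. gp_safe n t \<pi> f (1 - \<delta>) T}" "random_perms n t"]
    by (simp add: Compl_eq_Diff_UNIV)
  also have "\<dots> \<le> measure_pmf.prob (random_perms n t) (\<Union>F\<in>?\<F>. ?E F)"
  proof (intro measure_pmf.finite_measure_mono subsetI)
    fix \<pi> assume "\<pi> \<in> - {\<pi>. gp_safe n t \<pi> f (1 - \<delta>) T}"
    then obtain F where F: "F \<in> ?\<F>"
      "measure_pmf.prob (pmf_of_set {1..t}) {i. real (gp_runtime n (\<pi> i) F) \<le> T} < 1 - \<delta>"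
      by (auto simp: gp_safe_def not_le)
    let ?G = "{1..t} \<inter> {i. real (gp_runtime n (\<pi> i) F) \<le> T}"
    have "real (card ?G) < (1 - \<delta>) * real t"
      using F(2) t by (subst (asm) measure_pmf_of_set) (auto simp: divide_less_eq)
    moreover have "{i \<in> {1..t}. \<pi> i \<in> ?B F} = {1..t} - ?G"
      by auto
    then have "real (card {i \<in> {1..t}. \<pi> i \<in> ?B F}) = real t - real (card ?G)"
      using card_mono[of "{1..t}" ?G] by (simp add: card_Diff_subset of_nat_diff)
    ultimately have "\<pi> \<in> ?E F" by (simp add: algebra_simps)
    with F(1) show "\<pi> \<in> (\<Union>F\<in>?\<F>. ?E F)" by blast
  qed simp
  also have "\<dots> \<le> (\<Sum>F\<in>?\<F>. measure_pmf.prob (random_perms n t) (?E F))"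
    using fin by (intro measure_UNION_le) auto
  also have "\<dots> \<le> (\<Sum>F\<in>?\<F>. 2 ^ t * q powr (\<delta> * real t))"
  proof (rule sum_mono)
    fix F assume F: "F \<in> ?\<F>"
    have "measure_pmf.prob ?D (?B F) \<le> real n * (real (n - 1) ^ a * (1 - p + p * 2 / 2 ^ a) ^ k)"
      using F p by (intro prob_gp_runtime_gt_le n k) auto
    also note q(1)
    finally show "measure_pmf.prob (random_perms n t) (?E F) \<le> 2 ^ t * q powr (\<delta> * real t)"
      unfolding random_perms_def
      using prob_Pi_pmf_many_le[of "{1..t}" ?D "?B F" q id "\<delta> * real t"] q(2,3) by simp
  qed
  also have "\<dots> = real (card ?\<F>) * (2 ^ t * q powr (\<delta> * real t))" by simp
  also have "\<dots> \<le> real (card (Pow {1..n-1})) * (2 ^ t * q powr (\<delta> * real t))"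
    by (intro mult_right_mono of_nat_mono card_mono) auto
  finally show ?thesis by (simp add: card_Pow)
qed

section \<open>Choice of parameters and asymptotics\<close>

text \<open>For exponent 3 the factor per round is \<open>1 - 3 / 4 * p\<close>, at most
  \<open>exp (- 3 / 4 * p)\<close>. The round count times \<open>p\<close> is at least
  \<open>6 * ln m\<close>, which gives \<open>9 / 2\<close>.\<close>

lemma failure_decay_le:
  fixes n f :: nat and p \<epsilon> T :: real
  assumes n: "n \<ge> 2" and \<epsilon>: "0 \<le> \<epsilon>" "\<epsilon> < p" and p: "p \<le> 1"
    and T: "T = 6 / (p - \<epsilon>) * (of_int \<lceil>log 2 (real n - 1)\<rceil> + 1)"
  shows "real (nat \<lfloor>T\<rfloor>) \<le> T"
    and "(1 - p + p * 2 / 2 ^ 3) ^ nat \<lfloor>T\<rfloor> \<le> exp (- (9 / 2) * ln (real n - 1))"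
proof -
  define m where "m = real n - 1"
  define k where "k = nat \<lfloor>T\<rfloor>"
  have m: "m \<ge> 1" using n by (simp add: m_def)
  have "ln m * ln 2 \<le> ln m * 1"
    using m ln_2_less_1 by (intro mult_left_mono) auto
  then have log: "0 \<le> ln m" "ln m \<le> log 2 m"
    using m by (auto simp: log_def le_divide_eq)
  have L: "log 2 m + 1 \<le> of_int \<lceil>log 2 m\<rceil> + 1" by simp
  have "6 / p * (log 2 m + 1) \<le> 6 / (p - \<epsilon>) * (of_int \<lceil>log 2 m\<rceil> + 1)"
    using \<epsilon> log by (intro mult_mono L divide_left_mono) auto
  then have T_ge: "6 / p * (log 2 m + 1) \<le> T" by (simp add: T m_def)
  moreover have "0 \<le> 6 / p * (log 2 m + 1)" using \<epsilon> log by simp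
  ultimately have T0: "0 \<le> T" by linarith
  then show "real (nat \<lfloor>T\<rfloor>) \<le> T" by simp
  have kT: "T - 1 \<le> real k" using T0 unfolding k_def by linarith
  \<comment> \<open>The \<open>+ 1\<close> after the logarithm contributes 6, which pays for the
    loss of at most \<open>p\<close> from rounding \<open>T\<close> down.\<close>
  have "p * (6 / p * (log 2 m + 1)) - p * 1 \<le> p * real k"
    unfolding right_diff_distrib[symmetric] using \<epsilon> T_ge kT by (intro mult_left_mono) auto
  then have pk: "6 * ln m \<le> p * real k"
  proof -
    have "p * (6 / p * (log 2 m + 1)) = 6 * (log 2 m + 1)" using \<epsilon> by simp
    with \<open>p * (6 / p * (log 2 m + 1)) - p * 1 \<le> p * real k\<close> show ?thesis using p log by simp
  qed
  have "1 - p + p * 2 / 2 ^ 3 = 1 + (- (3 / 4) * p)" by simp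
  also have "\<dots> \<le> exp (- (3 / 4) * p)" by (rule exp_ge_add_one_self)
  finally have "(1 - p + p * 2 / 2 ^ 3) ^ k \<le> exp (- (3 / 4) * p) ^ k"
    using p \<epsilon> by (intro power_mono) auto
  also have "\<dots> = exp (- (3 / 4) * (p * real k))"
    by (simp flip: exp_of_nat_mult add: mult_ac)
  also have "\<dots> \<le> exp (- (9 / 2) * ln m)"
    using pk by simp
  finally show "(1 - p + p * 2 / 2 ^ 3) ^ nat \<lfloor>T\<rfloor> \<le> exp (- (9 / 2) * ln (real n - 1))"
    by (simp add: k_def m_def)
qed

lemma two_power_le_exp: "(2::real) ^ n \<le> exp (real n)"
proof -
  have "(2::real) ^ n \<le> exp 1 ^ n"
    using exp_ge_add_one_self[of 1] by (intro power_mono) auto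
  then show ?thesis by (simp flip: exp_of_nat_mult)
qed

theorem theorem14:
  fixes t f :: "nat \<Rightarrow> nat" and \<epsilon> p :: "nat \<Rightarrow> real"
  assumes t: "(\<lambda>n. real (t n)) \<in> \<omega>(\<lambda>n. real n / log 2 (real n))"
    and \<epsilon>: "\<And>n. \<epsilon> n = sqrt (ln (real n) / (real n - 1))"
    and f: "\<And>n. n \<ge> 2 \<Longrightarrow> real (f n) < (real n - 1) * (1 - \<epsilon> n)"
    and p: "\<And>n. p n = 1 - real (f n) / (real n - 1)"
  shows "\<exists>c \<delta> e :: nat \<Rightarrow> real.
           e \<longlonglongrightarrow> 0 \<and> (\<forall>n. c n \<le> 6 + e n) \<and> \<delta> \<longlonglongrightarrow> 0 \<and>
           (\<lambda>n. 1 - measure_pmf.prob (random_perms n (t n))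
                  {\<pi>. gp_safe n (t n) \<pi> (f n) (1 - \<delta> n)
                       (c n / (p n - \<epsilon> n) * (of_int \<lceil>log 2 (real n - 1)\<rceil> + 1))})
             \<in> o(\<lambda>n. 1 / real n)"
proof -
  define r where "r n = real n / (real (t n) * ln (real n))" for n
  \<comment> \<open>The first summand is to beat the \<open>2 ^ t n\<close> index sets, the second
    the \<open>2 ^ (n - 1)\<close> failure patterns.\<close>
  define \<delta> where "\<delta> n = 1 / sqrt (ln (real n)) + sqrt (r n)" for n
  define T where "T n = 6 / (p n - \<epsilon> n) * (of_int \<lceil>log 2 (real n - 1)\<rceil> + 1)" for n
  let ?unsafe = "\<lambda>n. 1 - measure_pmf.prob (random_perms n (t n))
    {\<pi>. gp_safe n (t n) \<pi> (f n) (1 - \<delta> n) (T n)}"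
  have "(\<lambda>n. real n / log 2 (real n)) \<in> o(\<lambda>n. real (t n))"
    using t by (simp add: smallomega_iff_smallo)
  from smalloD_tendsto[OF this]
  \<comment> \<open>Dividing by \<open>ln 2\<close> converts the binary logarithm to the natural one
    in \<open>r\<close>.\<close>
  have "(\<lambda>n. real n / log 2 (real n) / real (t n) / ln 2) \<longlonglongrightarrow> 0 / ln 2"
    by (intro tendsto_divide tendsto_const) auto
  then have r: "r \<longlonglongrightarrow> 0"
    by (simp add: r_def[abs_def] log_def mult.commute)
  have \<delta>: "\<delta> \<longlonglongrightarrow> 0"
  proof -
    have "(\<lambda>n. 1 / sqrt (ln (real n))) \<longlonglongrightarrow> 0" by real_asymp
    then have "\<delta> \<longlonglongrightarrow> 0 + sqrt 0"
      unfolding \<delta>_def[abs_def] by (intro tendsto_add tendsto_real_sqrt r)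
    then show ?thesis by simp
  qed
  \<comment> \<open>The bound 1/256 will give \<open>16 * r n \<le> sqrt (r n)\<close>; the bound 16
    on the logarithm below will give a square root of at least 4.\<close>
  have ev_r: "\<forall>\<^sub>F n in sequentially. r n < 1 / 256"
    using r by (rule order_tendstoD) simp
  have ev_t: "\<forall>\<^sub>F n in sequentially. real (t n) \<ge> 1 * norm (real n / log 2 (real n))"
    using landau_omega.smallD[OF t, of 1] by simp
  have ev_ln: "\<forall>\<^sub>F n in sequentially. ln (real n) \<ge> 16" by real_asymp
  \<comment> \<open>The left side is of order \<open>n powr (- (1 / 2))\<close>, since 1 + 3 - 9/2 =
    -1/2; the weaker exponent absorbs the lower-order deviation.\<close>
  have ev_q: "\<forall>\<^sub>F n in sequentially.
      real n * ((real n - 1) ^ 3 * exp (- (9 / 2) * ln (real n - 1))) \<le> real n powr (- (1 / 4))"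
    by real_asymp
  have "\<forall>\<^sub>F n in sequentially. norm (?unsafe n) \<le> 1 * norm (exp (- 3 * real n))"
    using ev_r ev_t ev_ln ev_q eventually_ge_at_top[of 2]
  proof eventually_elim
    case (elim n)
    let ?q = "real n powr (- (1 / 4))"
    have n: "n \<ge> 2" "real (n - 1) = real n - 1" using elim by auto
    have "real n / log 2 (real n) > 0" using n by simp
    then have t0: "t n > 0" using elim(2) by (cases "t n") auto
    have \<epsilon>0: "0 \<le> \<epsilon> n" using n by (simp add: \<epsilon>)
    have "\<epsilon> n < p n" using f[OF n(1)] n by (simp add: p field_simps)
    moreover have "p n \<le> 1" using n by (simp add: p)
    ultimately have decay: "real (nat \<lfloor>T n\<rfloor>) \<le> T n"
      "(1 - p n + p n * 2 / 2 ^ 3) ^ nat \<lfloor>T n\<rfloor> \<le> exp (- (9 / 2) * ln (real n - 1))"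
      using failure_decay_le[OF n(1) \<epsilon>0 _ _ T_def] by auto
    have "real n * (real (n - 1) ^ 3 * (1 - p n + p n * 2 / 2 ^ 3) ^ nat \<lfloor>T n\<rfloor>) \<le> ?q"
    proof -
      have "real n * (real (n - 1) ^ 3 * (1 - p n + p n * 2 / 2 ^ 3) ^ nat \<lfloor>T n\<rfloor>) \<le>
          real n * ((real n - 1) ^ 3 * exp (- (9 / 2) * ln (real n - 1)))"
        unfolding n(2) using n decay(2) by (intro mult_left_mono) auto
      then show ?thesis using elim(4) by linarith
    qed
    moreover have "?q \<le> 1"
      using powr_mono[of "- (1 / 4)" 0 "real n"] n by simp
    ultimately have "?unsafe n \<le> 2 ^ (n - 1) * (2 ^ t n * ?q powr (\<delta> n * real (t n)))"
      using n by (intro prob_not_gp_safe_le[where k = "nat \<lfloor>T n\<rfloor>" and a = 3, OF n(1) t0 decay(1) p]) auto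
    \<comment> \<open>It suffices that \<open>\<delta> n * t n * ln n\<close> is at least
      \<open>4 * t n + 16 * n\<close>, as \<open>?q\<close> contributes the factor 1/4 in the
      exponent.\<close>
    also have "\<dots> \<le> exp (real n) * (exp (real (t n)) * exp (- (real (t n) + 4 * real n)))"
    proof (intro mult_mono)
      have "(2::real) ^ (n - 1) \<le> 2 ^ n" by (intro power_increasing) auto
      then show "(2::real) ^ (n - 1) \<le> exp (real n)" using two_power_le_exp[of n] by linarith
      have ln0: "ln (real n) > 0" using elim(3) by linarith
      have sq: "sqrt (ln (real n)) \<ge> 4" using elim(3) by (intro real_le_rsqrt) simp
      have r0: "r n > 0" using t0 ln0 n by (simp add: r_def)
      have "sqrt (r n) < 1 / 16"
        using elim(1) by (intro real_less_lsqrt) (simp_all add: power2_eq_square)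
      then have "16 * sqrt (r n) * sqrt (r n) \<le> 1 * sqrt (r n)"
        using r0 by (intro mult_right_mono) auto
      then have rr: "16 * r n \<le> sqrt (r n)"
        using r0 by (simp only: mult.assoc real_sqrt_mult_self abs_of_pos mult_1)
      \<comment> \<open>By definition of \<open>r\<close>, the product
        \<open>t n * ln n * r n\<close> is just \<open>n\<close>.\<close>
      have "real (t n) * 4 + 16 * real n \<le>
          real (t n) * sqrt (ln (real n)) + real (t n) * ln (real n) * (16 * r n)"
        using sq t0 ln0 by (intro add_mono mult_left_mono) (auto simp: r_def)
      also have "\<dots> \<le> real (t n) * sqrt (ln (real n)) + real (t n) * ln (real n) * sqrt (r n)"
        using rr t0 ln0 by (intro add_mono mult_left_mono) auto
      also have "real (t n) * sqrt (ln (real n)) = real (t n) * ln (real n) * (1 / sqrt (ln (real n)))"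
      proof -
        have "ln (real n) * (1 / sqrt (ln (real n))) = sqrt (ln (real n))"
          using real_div_sqrt[of "ln (real n)"] ln0 by simp
        then show ?thesis by (simp only: mult.assoc)
      qed
      finally have "real (t n) * 4 + 16 * real n \<le> \<delta> n * real (t n) * ln (real n)"
        by (simp add: \<delta>_def algebra_simps)
      then have "- (1 / 4) * (\<delta> n * real (t n)) * ln (real n) \<le> - (real (t n) + 4 * real n)"
        by simp
      then show "?q powr (\<delta> n * real (t n)) \<le> exp (- (real (t n) + 4 * real n))"
        unfolding powr_powr using n by (simp add: powr_def)
    qed (simp_all add: two_power_le_exp)
    also have "\<dots> = exp (- 3 * real n)"
      by (simp flip: exp_add)
    finally show ?case
      using measure_pmf.prob_le_1[of "random_perms n (t n)"] by simp
  qed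
  then have "?unsafe \<in> O(\<lambda>n. exp (- 3 * real n))"
    by (rule bigoI)
  moreover have "(\<lambda>n. exp (- 3 * real n)) \<in> o(\<lambda>n. 1 / real n)"
    by real_asymp
  ultimately have "?unsafe \<in> o(\<lambda>n. 1 / real n)"
    by (rule landau_o.big_small_trans)
  then show ?thesis
    using \<delta> unfolding T_def
    \<comment> \<open>The constant 6 serves as \<open>c\<close>, with error term \<open>e\<close>
      identically 0.\<close>
    by (intro exI[of _ "\<lambda>_. 6"] exI[of _ \<delta>] exI[of _ "\<lambda>_. 0"]) auto
qed

end
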